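(* Let $n>1$, let $L\subset\mathbb{P}^n$ be a line with $L\cap\Delta_{n-2}=\emptyset$, and let $1\le r<n$. Then the following hold. (1) If $L=\mathrm{rowspan}\begin{pmatrix} a_{00}&a_{01}&\dots&a_{0n}\\ a_{10}&a_{11}&\dots&a_{1n}\end{pmatrix}$, then \[L^{\star r}=\mathrm{rowspan}\begin{pmatrix} a_{00}^{r}&a_{01}^{r}&\dots&a_{0n}^{r}\\ a_{00}^{r-1}a_{10}&a_{01}^{r-1}a_{11}&\dots&a_{0n}^{r-1}a_{1n}\\ \dots&\dots&\dots&\dots\\ a_{10}^{r}&a_{11}^{r}&\dots&a_{1n}^{r}\end{pmatrix},\] the $(r+1)\times(n+1)$ matrix whose $s$-th row ($0\le s\le r$) has entries $a_{0i}^{r-s}a_{1i}^{s}$, $0\le i\le n$. (2) In terms of Plücker coordinates, if $0\le i_0<i_1<\dots<i_r\le n$, then \[[i_0,i_1,\dots,i_r]_{L^{\star r}}=\prod_{0\le j<k\le r}[i_j,i_k]_L.\]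
   Context: The base field is $\mathbb{C}$. $\Delta_i\subset\mathbb{P}^n$ is the set of points having at most $i+1$ non-zero homogeneous coordinates. For points $p=[a_0:\dots:a_n]$, $q=[b_0:\dots:b_n]$ of $\mathbb{P}^n$, the Hadamard product $p\star q=[a_0b_0:\dots:a_nb_n]$ is defined when some $a_ib_i\neq0$, and is not defined otherwise. For varieties $X,Y\subset\mathbb{P}^n$, $X\star Y$ is the Zariski closure of $\{p\star q: p\in X,\ q\in Y,\ p\star q \text{ is defined}\}$. Hadamard powers are $X^{\star 0}=\{[1:\dots:1]\}$ and $X^{\star r}=X\star X^{\star(r-1)}$. A linear space in $\mathbb{P}^n$ written as the rowspan of a matrix is the projectivization of the row space. For a linear space $M\subset\mathbb{P}^n$ of dimension $d$ given as the rowspan of a $(d+1)\times(n+1)$ matrix of full rank, its Plücker coordinate $[i_0,\dots,i_d]_M$ is the maximal minor on columns $i_0,\dots,i_d$; the tuple of Plücker coordinates is well defined up to a common non-zero scalar, and the equality in (2) is understood in this sense (it is an equality of maximal minors when $L$ and $L^{\star r}$ are represented by the matrices in (1)). *)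

theory Defs
  imports
    "HOL-Library.Poly_Mapping"
    "Jordan_Normal_Form.DL_Rank"
begin

section \<open>Projective space over the complex numbers\<close>

text \<open>Vectors of homogeneous coordinates are elements of \<^term>\<open>carrier_vec (Suc n)\<close>, and a point
  is the set of all its coordinate vectors.\<close>

definition proj_point :: "complex vec \<Rightarrow> complex vec set" where
  "proj_point v = {c \<cdot>\<^sub>v v | c. c \<noteq> 0}"

definition projectivization :: "nat \<Rightarrow> complex vec set \<Rightarrow> complex vec set set" where
  "projectivization n W = {proj_point v | v. v \<in> W \<and> v \<noteq> 0\<^sub>v (Suc n)}"

definition proj_space :: "nat \<Rightarrow> complex vec set set" where
  "proj_space n = projectivization n (carrier_vec (Suc n))"

definition Delta :: "nat \<Rightarrow> nat \<Rightarrow> complex vec set set" where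
  "Delta n i = {p \<in> proj_space n. \<forall>v\<in>p. card {j. j \<le> n \<and> v $ j \<noteq> 0} \<le> i + 1}"

definition proj_linear_space :: "nat \<Rightarrow> nat \<Rightarrow> complex vec set set \<Rightarrow> bool" where
  "proj_linear_space n d M \<longleftrightarrow>
     (\<exists>W. subspace class_ring W (module_vec TYPE(complex) (Suc n)) \<and>
          vectorspace.dim class_ring
            (module_vec TYPE(complex) (Suc n) \<lparr>carrier := W\<rparr>) = Suc d \<and>
          M = projectivization n W)"

definition proj_rowspan :: "nat \<Rightarrow> complex mat \<Rightarrow> complex vec set set" where
  "proj_rowspan n A = projectivization n (vec_space.row_space (Suc n) A)"


section \<open>Zariski closure\<close>

text \<open>A polynomial in countably many variables, indexed by \<^typ>\<open>nat\<close>, is a finitely supported map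
  from exponent vectors to coefficients; the homogeneous coordinate ring of projective
  \<open>n\<close>-space consists of the polynomials in the variables \<open>0, \<dots>, n\<close>.\<close>

type_synonym mpoly = "(nat \<Rightarrow>\<^sub>0 nat) \<Rightarrow>\<^sub>0 complex"

definition mpoly_eval :: "mpoly \<Rightarrow> complex vec \<Rightarrow> complex" where
  "mpoly_eval F v =
     (\<Sum>m\<in>Poly_Mapping.keys F. Poly_Mapping.lookup F m *
        (\<Prod>j\<in>Poly_Mapping.keys m. (v $ j) ^ Poly_Mapping.lookup m j))"

definition homogeneous :: "nat \<Rightarrow> mpoly \<Rightarrow> bool" where
  "homogeneous n F \<longleftrightarrow>
     (\<forall>m\<in>Poly_Mapping.keys F. Poly_Mapping.keys m \<subseteq> {..n}) \<and>
     (\<exists>d. \<forall>m\<in>Poly_Mapping.keys F. (\<Sum>j\<in>Poly_Mapping.keys m. Poly_Mapping.lookup m j) = d)"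

definition zariski_closed :: "nat \<Rightarrow> complex vec set set \<Rightarrow> bool" where
  "zariski_closed n Z \<longleftrightarrow>
     (\<exists>S. (\<forall>F\<in>S. homogeneous n F) \<and>
          Z = {p \<in> proj_space n. \<forall>F\<in>S. \<forall>v\<in>p. mpoly_eval F v = 0})"

definition zariski_closure :: "nat \<Rightarrow> complex vec set set \<Rightarrow> complex vec set set" where
  "zariski_closure n X = zariski_closed n hull X"


section \<open>Hadamard products and powers\<close>

text \<open>\<^const>\<open>component_mult\<close> is the entrywise product of coordinate vectors. The side condition
  says that the product of the two points is defined.\<close>

definition hadamard_product ::
    "nat \<Rightarrow> complex vec set set \<Rightarrow> complex vec set set \<Rightarrow> complex vec set set" where
  "hadamard_product n X Y = zariski_closure n
     {proj_point (component_mult u v) | u v.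
        proj_point u \<in> X \<and> proj_point v \<in> Y \<and> (\<exists>i\<le>n. u $ i * v $ i \<noteq> 0)}"

fun hadamard_power :: "nat \<Rightarrow> complex vec set set \<Rightarrow> nat \<Rightarrow> complex vec set set" where
  "hadamard_power n X 0 = {proj_point (vec (Suc n) (\<lambda>_. 1))}"
| "hadamard_power n X (Suc r) = hadamard_product n X (hadamard_power n X r)"

definition power_matrix :: "nat \<Rightarrow> complex mat \<Rightarrow> complex mat" where
  "power_matrix r A = mat (Suc r) (dim_col A)
     (\<lambda>(s, i). (A $$ (0, i)) ^ (r - s) * (A $$ (1, i)) ^ s)"


section \<open>Pluecker coordinates\<close>

text \<open>The list \<open>ix\<close> holds the selected columns; its length is meant to be the number of rows.\<close>

definition maximal_minor :: "complex mat \<Rightarrow> nat list \<Rightarrow> complex" where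
  "maximal_minor B ix = det (mat (dim_row B) (length ix) (\<lambda>(s, k). B $$ (s, ix ! k)))"

definition index_lists :: "nat \<Rightarrow> nat \<Rightarrow> nat list set" where
  "index_lists n d = {ix. length ix = Suc d \<and> sorted_wrt (<) ix \<and> set ix \<subseteq> {..n}}"

text \<open>\<open>P\<close> is one of the tuples of Pluecker coordinates of the \<open>d\<close>-dimensional linear space \<open>M\<close>,
  namely the one obtained from some full rank matrix representing \<open>M\<close>.\<close>

definition plucker_coordinates ::
    "nat \<Rightarrow> nat \<Rightarrow> complex vec set set \<Rightarrow> (nat list \<Rightarrow> complex) \<Rightarrow> bool" where
  "plucker_coordinates n d M P \<longleftrightarrow>
     (\<exists>B \<in> carrier_mat (Suc d) (Suc n).
        vec_space.rank (Suc d) B = Suc d \<and> M = proj_rowspan n B \<and> P = maximal_minor B)"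

end

theory Submission
  imports
    "HOL-Computational_Algebra.Fundamental_Theorem_Algebra"
    Defs
begin

text \<open>The row space of the \<open>r\<close>-th power matrix
  consists of the vectors of values of binary forms of degree \<open>r\<close> at the \<open>n + 1\<close> points
  \<open>(a\<^sub>0\<^sub>i, a\<^sub>1\<^sub>i)\<close>. Over the complex numbers every form of degree \<open>r + 1\<close> is the product of a linear
  form and a form of degree \<open>r\<close>, so the set of Hadamard products of points of the line and of the
  \<open>r\<close>-th power space is already the whole \<open>(r + 1)\<close>-st power space; being linear, it is Zariski closed.
  The maximal minors of the power matrix are homogeneous Vandermonde determinants, and avoiding
  \<open>\<Delta>\<^sub>n\<^sub>-\<^sub>2\<close> means that no \<open>2 \<times> 2\<close> minor of the line vanishes.\<close>

section \<open>Binary forms\<close>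

text \<open>Indexing by the exponent of \<open>y\<close> matches the row order of
  \<open>power_matrix\<close>, so \<open>c\<close> lists the coefficients of a combination of its
  rows. Only \<open>c 0\<close>, ..., \<open>c r\<close> matter.\<close>

definition binary_form :: "nat \<Rightarrow> (nat \<Rightarrow> complex) \<Rightarrow> complex \<Rightarrow> complex \<Rightarrow> complex" where
  "binary_form r c x y = (\<Sum>s\<le>r. c s * (x ^ (r - s) * y ^ s))"

text \<open>Multiplying by \<open>\<alpha> * x\<close> pads the coefficients with 0 at the top
  index; multiplying by \<open>\<beta> * y\<close> shifts them up by one.\<close>

lemma binary_form_linear_mult:
  "(\<alpha> * x + \<beta> * y) * binary_form r d x y =
   binary_form (Suc r) (\<lambda>s. (if s \<le> r then \<alpha> * d s else 0) + (case s of 0 \<Rightarrow> 0 | Suc t \<Rightarrow> \<beta> * d t)) x y"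
proof -
  have "\<alpha> * x * binary_form r d x y =
      (\<Sum>s\<le>r. (if s \<le> r then \<alpha> * d s else 0) * (x ^ (Suc r - s) * y ^ s))"
    unfolding binary_form_def sum_distrib_left
    by (intro sum.cong) (auto simp: Suc_diff_le)
  also have "\<dots> = binary_form (Suc r) (\<lambda>s. if s \<le> r then \<alpha> * d s else 0) x y"
    by (simp add: binary_form_def)
  finally have "\<alpha> * x * binary_form r d x y = \<dots>" .
  moreover have "\<beta> * y * binary_form r d x y =
      binary_form (Suc r) (\<lambda>s. case s of 0 \<Rightarrow> 0 | Suc t \<Rightarrow> \<beta> * d t) x y"
    unfolding binary_form_def sum_distrib_left sum.atMost_Suc_shift
    by (auto intro!: sum.cong)
  ultimately show ?thesis
    by (simp add: binary_form_def distrib_right sum.distrib)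
qed

lemma binary_form_cong:
  "(\<And>s. s \<le> r \<Longrightarrow> c s = d s) \<Longrightarrow> binary_form r c x y = binary_form r d x y"
  by (simp add: binary_form_def)

text \<open>If the coefficient of \<open>y ^ Suc r\<close> vanishes, \<open>x\<close> is a factor.
  Otherwise setting \<open>x = 1\<close> gives a polynomial of degree \<open>Suc r\<close>, and a
  root \<open>z\<close> of it yields the factor \<open>y - z * x\<close>.\<close>

lemma binary_form_split_linear:
  obtains \<alpha> \<beta> d where
    "\<And>x y. binary_form (Suc r) c x y = (\<alpha> * x + \<beta> * y) * binary_form r d x y"
proof (cases "c (Suc r) = 0")
  case True
  have "binary_form (Suc r) c x y = (1 * x + 0 * y) * binary_form r c x y" for x y
    unfolding binary_form_linear_mult
    by (rule binary_form_cong) (use True in \<open>auto simp: le_Suc_eq split: nat.split\<close>)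
  then show ?thesis by (rule that)
next
  case False
  define P where "P = Poly (map c [0..<Suc (Suc r)])"
  have coeff_P: "coeff P s = (if s \<le> Suc r then c s else 0)" for s
    by (auto simp: P_def nth_default_def simp del: upt_Suc)
  have "degree P = Suc r"
    by (rule antisym, rule degree_le, simp add: coeff_P, rule le_degree, simp add: coeff_P False)
  then have "\<not> constant (poly P)"
    by (simp add: constant_degree)
  then obtain z where "poly P z = 0"
    using fundamental_theorem_of_algebra by blast
  then obtain Q where Q: "P = [:- z, 1:] * Q"
    by (auto simp: poly_eq_0_iff_dvd dvd_def)
  with False have "Q \<noteq> 0"
    using coeff_P[of "Suc r"] by auto
  then have "degree P = Suc (degree Q)"
    unfolding Q by (subst degree_mult_eq) auto
  with \<open>degree P = Suc r\<close> have "degree Q = r"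
    by simp
  have "c s = (if s \<le> r then (- z) * coeff Q s else 0)
      + (case s of 0 \<Rightarrow> 0 | Suc t \<Rightarrow> 1 * coeff Q t)" if "s \<le> Suc r" for s
  proof -
    have "c s = coeff P s"
      using that by (simp add: coeff_P)
    \<comment> \<open>At \<open>s = Suc r\<close> the guard \<open>s \<le> r\<close> drops the term
      with \<open>coeff Q s\<close>, which is 0 anyway.\<close>
    moreover have "coeff Q (Suc r) = 0"
      using \<open>degree Q = r\<close> by (simp add: coeff_eq_0)
    ultimately show ?thesis
      using that by (auto simp: Q coeff_pCons le_Suc_eq split: nat.split)
  qed
  then have "binary_form (Suc r) c x y = ((- z) * x + 1 * y) * binary_form r (coeff Q) x y" for x y
    unfolding binary_form_linear_mult by (rule binary_form_cong)
  then show ?thesis by (rule that)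
qed

section \<open>The homogeneous Vandermonde determinant\<close>

lemma det_scale_cols:
  fixes f :: "nat \<Rightarrow> nat \<Rightarrow> 'a :: comm_ring_1"
  shows "det (mat m m (\<lambda>(i, j). f i j * c j)) = det (mat m m (\<lambda>(i, j). f i j)) * (\<Prod>j<m. c j)"
proof -
  have "det (mat_diag m c) = (\<Prod>j<m. c j)"
    by (subst det_upper_triangular[of _ m])
      (auto simp: mat_diag_def diag_mat_def atLeast0LessThan prod.list_conv_set_nth
        simp flip: prod.distinct_set_conv_list intro!: prod.cong)
  moreover have "mat m m (\<lambda>(i, j). f i j * c j) = mat m m (\<lambda>(i, j). f i j) * mat_diag m c"
    by (subst mat_diag_mult_right[of _ m]) auto
  ultimately show ?thesis
    by (simp add: det_mult[of _ m])
qed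

text \<open>Laplace expansion with a single surviving term; the row index of the remaining matrix
  jumps over the deleted row \<open>i\<close>.\<close>

lemma det_expand_first_col:
  fixes f :: "nat \<Rightarrow> nat \<Rightarrow> 'a :: comm_ring_1"
  assumes "i \<le> m" "\<And>k. k \<le> m \<Longrightarrow> k \<noteq> i \<Longrightarrow> f k 0 = 0"
  shows "det (mat (Suc m) (Suc m) (\<lambda>(k, j). f k j)) =
    f i 0 * (-1) ^ i * det (mat m m (\<lambda>(k, j). f (if k < i then k else Suc k) (Suc j)))"
proof -
  let ?M = "mat (Suc m) (Suc m) (\<lambda>(k, j). f k j)"
  have "det ?M = (\<Sum>k<Suc m. ?M $$ (k, 0) * cofactor ?M k 0)"
    by (rule laplace_expansion_column) auto
  also have "\<dots> = (\<Sum>k\<in>{i}. ?M $$ (k, 0) * cofactor ?M k 0)"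
    by (rule sum.mono_neutral_right) (use assms in auto)
  also have "mat_delete ?M i 0 = mat m m (\<lambda>(k, j). f (if k < i then k else Suc k) (Suc j))"
    unfolding mat_delete_def by (rule eq_matI) auto
  then have "(\<Sum>k\<in>{i}. ?M $$ (k, 0) * cofactor ?M k 0) =
      f i 0 * (-1) ^ i * det (mat m m (\<lambda>(k, j). f (if k < i then k else Suc k) (Suc j)))"
    using assms(1) by (simp add: cofactor_def)
  finally show ?thesis .
qed

lemma prod_ordered_pairs_Suc:
  fixes g :: "nat \<Rightarrow> nat \<Rightarrow> 'a :: comm_monoid_mult"
  shows "(\<Prod>(j, k) \<in> {(j, k). j < k \<and> k \<le> Suc r}. g j k) =
    (\<Prod>k\<le>r. g 0 (Suc k)) * (\<Prod>(j, k) \<in> {(j, k). j < k \<and> k \<le> r}. g (Suc j) (Suc k))"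
proof -
  let ?S = "{(j, k). j < k \<and> k \<le> r}"
  have fin: "finite ?S"
    by (rule finite_subset[of _ "{..r} \<times> {..r}"]) auto
  \<comment> \<open>Pairs starting at 0 are separated from those with both entries positive; the
    latter are shifts by one of the pairs for \<open>r\<close>.\<close>
  have split: "{(j, k). j < k \<and> k \<le> Suc r} =
      (\<lambda>k. (0, Suc k)) ` {..r} \<union> map_prod Suc Suc ` ?S"
  proof (rule Set.set_eqI)
    fix p :: "nat \<times> nat"
    obtain j k where "p = (j, k)" by (cases p)
    then show "p \<in> {(j, k). j < k \<and> k \<le> Suc r} \<longleftrightarrow>
        p \<in> (\<lambda>k. (0, Suc k)) ` {..r} \<union> map_prod Suc Suc ` ?S"
      by (cases j; cases k) (auto simp: image_iff)
  qed
  show ?thesis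
    unfolding split
    by (subst prod.union_disjoint)
      (use fin in \<open>auto simp: prod.reindex inj_on_def case_prod_unfold intro!: prod.cong\<close>)
qed

text \<open>Induction on \<open>r\<close>: the first column is reduced to at most one nonzero entry.
  Each remaining column then contributes a factor \<open>x 0 * y (Suc k) - x (Suc k) * y 0\<close>,
  and what is left is the determinant for the shifted points.\<close>

lemma det_homogeneous_vandermonde:
  fixes x y :: "nat \<Rightarrow> 'a :: field"
  shows "det (mat (Suc r) (Suc r) (\<lambda>(s, k). x k ^ (r - s) * y k ^ s)) =
    (\<Prod>(j, k) \<in> {(j, k). j < k \<and> k \<le> r}. x j * y k - x k * y j)"
proof (induction r arbitrary: x y)
  case 0
  have "det (mat (Suc 0) (Suc 0) (\<lambda>(s, k). x k ^ (0 - s) * y k ^ s)) = 1"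
    by (subst det_expand_first_col[of 0]) auto
  moreover have empty: "{(j::nat, k::nat). j < k \<and> k \<le> 0} = {}" by auto
  ultimately show ?case by (simp only: empty prod.empty)
next
  case (Suc r)
  let ?M = "mat (Suc (Suc r)) (Suc (Suc r)) (\<lambda>(s, k). x k ^ (Suc r - s) * y k ^ s)"
  let ?N = "mat (Suc r) (Suc r) (\<lambda>(s, k). x (Suc k) ^ (r - s) * y (Suc k) ^ s)"
  have "det ?M = (\<Prod>k\<le>r. x 0 * y (Suc k) - x (Suc k) * y 0) * det ?N"
  proof (cases "x 0 = 0")
    case True
    \<comment> \<open>With \<open>x 0 = 0\<close> only the last entry of the first column can be
      nonzero. Removing the last row leaves a factor \<open>x (Suc k)\<close> in every column, and
      the sign is absorbed into the powers of \<open>- y 0\<close>.\<close>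
    have "det ?M = y 0 ^ Suc r * (-1) ^ Suc r *
        det (mat (Suc r) (Suc r) (\<lambda>(s, k). x (Suc k) ^ (r - s) * y (Suc k) ^ s * x (Suc k)))"
    proof -
      have "mat (Suc r) (Suc r) (\<lambda>(s, k). x (Suc k) ^ (Suc r - (if s < Suc r then s else Suc s)) *
            y (Suc k) ^ (if s < Suc r then s else Suc s)) =
          mat (Suc r) (Suc r) (\<lambda>(s, k). x (Suc k) ^ (r - s) * y (Suc k) ^ s * x (Suc k))"
        by (rule cong_mat) (auto simp: Suc_diff_le mult_ac)
      then show ?thesis
        by (subst det_expand_first_col[of "Suc r"]) (simp_all add: True power_0_left)
    qed
    also have "\<dots> = (\<Prod>k<Suc r. (- y 0) * x (Suc k)) * det ?N"
      unfolding det_scale_cols prod.distrib by (simp add: power_minus[of "y 0"] mult_ac)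
    finally show ?thesis
      by (simp add: True lessThan_Suc_atMost mult_ac)
  next
    case False
    text \<open>Subtracting \<open>y 0 / x 0\<close> times the previous row clears the first column below the top
      entry; all rows but the first are scaled by \<open>x 0\<close> to avoid the division.\<close>
    define E where "E = mat (Suc (Suc r)) (Suc (Suc r))
      (\<lambda>(i, j). if j = i then if i = 0 then 1 else x 0 else if Suc j = i then - y 0 else 0)"
    \<comment> \<open>The matrix after elimination: for \<open>s > 0\<close> the two monomials being
      combined share \<open>x k ^ (Suc r - s) * y k ^ (s - 1)\<close>, and the remaining factor
      vanishes at \<open>k = 0\<close>.\<close>
    define f where "f s k = (if s = 0 then x k ^ Suc r else
        x k ^ (Suc r - s) * y k ^ (s - 1) * (x 0 * y k - x k * y 0))" for s k
    have det_E: "det E = x 0 ^ Suc r"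
    proof -
      have "diag_mat E = 1 # replicate (Suc r) (x 0)"
        by (rule nth_equalityI) (auto simp: E_def diag_mat_def nth_Cons' simp del: upt_Suc)
      moreover have "det E = prod_list (diag_mat E)"
        by (rule det_lower_triangular[of "Suc (Suc r)"]) (auto simp: E_def)
      ultimately show ?thesis
        by (simp add: prod_list_replicate)
    qed
    have EM: "E * ?M = mat (Suc (Suc r)) (Suc (Suc r)) (\<lambda>(s, k). f s k)"
    proof (rule eq_matI)
      fix s k assume "s < dim_row (mat (Suc (Suc r)) (Suc (Suc r)) (\<lambda>(s, k). f s k))"
        "k < dim_col (mat (Suc (Suc r)) (Suc (Suc r)) (\<lambda>(s, k). f s k))"
      then have sk: "s < Suc (Suc r)" "k < Suc (Suc r)" by auto
      let ?g = "\<lambda>t. x k ^ (Suc r - t) * y k ^ t"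
      have "(E * ?M) $$ (s, k) = (\<Sum>t<Suc (Suc r). E $$ (s, t) * ?M $$ (t, k))"
        using sk by (simp add: E_def scalar_prod_def atLeast0LessThan del: sum.lessThan_Suc)
      also have "\<dots> = (\<Sum>t<Suc (Suc r).
          (if t = s then (if s = 0 then 1 else x 0) * ?g t else 0) +
          (if Suc t = s then - y 0 * ?g t else 0))"
        using sk by (intro sum.cong) (auto simp: E_def)
      also have "\<dots> = (if s = 0 then 1 else x 0) * ?g s
          + (\<Sum>t<Suc (Suc r). if Suc t = s then - y 0 * ?g t else 0)"
        using sk by (subst sum.distrib) (simp add: sum.delta del: sum.lessThan_Suc)
      also have "(\<Sum>t<Suc (Suc r). if Suc t = s then - y 0 * ?g t else 0) =
          (case s of 0 \<Rightarrow> 0 | Suc t \<Rightarrow> - y 0 * ?g t)"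
        using sk by (auto simp del: sum.lessThan_Suc split: nat.split)
      also have "(if s = 0 then 1 else x 0) * ?g s + \<dots> = f s k"
        using sk by (cases s) (auto simp: f_def Suc_diff_le algebra_simps)
      finally show "(E * ?M) $$ (s, k) = mat (Suc (Suc r)) (Suc (Suc r)) (\<lambda>(s, k). f s k) $$ (s, k)"
        using sk by simp
    qed (auto simp: E_def)
    \<comment> \<open>Both \<open>det E\<close> and the top left entry of \<open>E * ?M\<close>
      equal \<open>x 0 ^ Suc r\<close>, so they cancel.\<close>
    have "x 0 ^ Suc r * det ?M = det (E * ?M)"
      using det_mult[of E "Suc (Suc r)" ?M] det_E by (simp add: E_def)
    also have "\<dots> = x 0 ^ Suc r * det (mat (Suc r) (Suc r) (\<lambda>(s, k). f (Suc s) (Suc k)))"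
      unfolding EM by (subst det_expand_first_col[of 0]) (auto simp: f_def)
    also have "det (mat (Suc r) (Suc r) (\<lambda>(s, k). f (Suc s) (Suc k))) =
        det ?N * (\<Prod>k<Suc r. x 0 * y (Suc k) - x (Suc k) * y 0)"
      using det_scale_cols[of "Suc r" "\<lambda>s k. x (Suc k) ^ (r - s) * y (Suc k) ^ s"
          "\<lambda>k. x 0 * y (Suc k) - x (Suc k) * y 0"]
      by (simp add: f_def)
    finally show ?thesis
      using False by (simp add: lessThan_Suc_atMost mult_ac)
  qed
  then show ?case
    by (simp add: Suc.IH prod_ordered_pairs_Suc)
qed

section \<open>Row spaces and rank\<close>

text \<open>Independent subsets of \<open>W\<close> have at most \<open>dim\<close> elements, so one
  of largest size exists. It spans \<open>W\<close>, since any vector outside its span could be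
  added to it.\<close>

lemma (in vectorspace) fin_dim_subspace:
  assumes "fin_dim" "subspace K W V"
  shows "vectorspace.fin_dim K (vs W)"
proof -
  have W: "W \<subseteq> carrier V" "submodule K W V"
    using assms(2) by (auto simp: subspace_def submodule_def)
  let ?P = "\<lambda>S. finite S \<and> S \<subseteq> W \<and> lin_indpt S"
  have bound: "card S \<le> dim" if "?P S" for S
    using li_le_dim(2)[OF assms(1)] that W by blast
  have "?P {}"
    by (auto simp: lin_dep_def)
  then obtain S where S: "?P S" "\<And>T. ?P T \<Longrightarrow> card T \<le> card S"
    using bound ex_has_greatest_nat[of ?P "{}" card "Suc dim"] by (metis le_imp_less_Suc)
  have "W \<subseteq> span S"
  proof
    fix w assume w: "w \<in> W"
    show "w \<in> span S"
    proof (rule ccontr)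
      assume notin: "w \<notin> span S"
      have "w \<notin> S"
        using notin S(1) W span_mem by blast
      have "lin_indpt (S \<union> {w})"
        using lin_dep_iff_in_span[of S w] notin S(1) W w \<open>w \<notin> S\<close> by blast
      then have "?P (S \<union> {w})"
        using S(1) w by auto
      from S(2)[OF this] show False
        using \<open>w \<notin> S\<close> S(1) by simp
    qed
  qed
  moreover have "span S \<subseteq> W"
    using S(1) W span_is_subset by blast
  \<comment> \<open>So far spans were taken in \<open>V\<close>; for subsets of \<open>W\<close>
    they agree with spans inside \<open>vs W\<close>.\<close>
  ultimately have "LinearCombinations.module.span K (vs W) S = W"
    using span_li_not_depend(1)[of S W] S(1) W(2) by auto
  then show ?thesis
    using vectorspace.fin_dim_def[OF subspace_is_vs[OF assms(2)]] S(1) by auto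
qed

context vec_space
begin

lemma subspace_row_space:
  assumes "A \<in> carrier_mat k n"
  shows "subspace class_ring (row_space A) V"
  unfolding row_space_def using assms by (intro span_is_subspace) (auto simp: rows_def)

lemma subspaceD:
  assumes "subspace class_ring W V"
  shows "W \<subseteq> carrier_vec n" "0\<^sub>v n \<in> W" "\<And>c v. v \<in> W \<Longrightarrow> c \<cdot>\<^sub>v v \<in> W"
proof -
  have "submodule class_ring W V"
    using assms by (simp add: subspace_def)
  then show "W \<subseteq> carrier_vec n" "0\<^sub>v n \<in> W" "\<And>c v. v \<in> W \<Longrightarrow> c \<cdot>\<^sub>v v \<in> W"
    by (auto simp: submodule_def)
qed

text \<open>The rows are a basis of \<open>W\<close>, hence the exact row count. This represents a
  linear space given abstractly by a matrix.\<close>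

lemma subspace_eq_row_space:
  assumes "subspace class_ring W V"
  obtains A where "A \<in> carrier_mat (vectorspace.dim class_ring (vs W)) n" "W = row_space A"
proof -
  have vsW: "vectorspace class_ring (vs W)"
    using assms by (rule subspace_is_vs)
  have fd: "vectorspace.fin_dim class_ring (vs W)"
    using fin_dim_subspace[OF _ assms] by simp
  obtain b where b: "finite b" "vectorspace.basis class_ring (vs W) b"
    using vectorspace.finite_basis_exists[OF vsW fd] by blast
  obtain bs where bs: "set bs = b" "distinct bs"
    using finite_distinct_list[OF b(1)] by blast
  have len: "length bs = vectorspace.dim class_ring (vs W)"
    using vectorspace.dim_basis[OF vsW b] bs distinct_card by fastforce
  have bW: "b \<subseteq> W"
    using b(2) vectorspace.basis_def[OF vsW] by auto
  have "submodule class_ring W V"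
    using assms by (simp add: subspace_def)
  then have "W = span b"
    using b(2) vectorspace.basis_def[OF vsW] span_li_not_depend(1)[OF bW] by auto
  moreover have "row_space (mat_of_rows n bs) = span b"
    using bs(1) bW subspaceD(1)[OF assms] by (auto simp: row_space_def)
  ultimately show ?thesis
    by (intro that[of "mat_of_rows n bs"]) (auto simp: len)
qed

text \<open>Independence concerns the set of columns and does not see repetitions. Full rank first
  forces the columns to be distinct; only then does a nonzero kernel vector contradict their
  independence.\<close>

lemma rank_eq_nc_imp_kernel_trivial:
  assumes A: "A \<in> carrier_mat n nc" "rank A = nc"
    and v: "v \<in> carrier_vec nc" "A *\<^sub>v v = 0\<^sub>v n"
  shows "v = 0\<^sub>v nc"
proof (rule ccontr)
  assume "v \<noteq> 0\<^sub>v nc"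
  obtain S where S: "maximal S (\<lambda>T. T \<subseteq> set (cols A) \<and> lin_indpt T)"
    using maximal_exists[of "(\<lambda>T. T \<subseteq> set (cols A) \<and> lin_indpt T)" "card (set (cols A))" "{}"]
    by (meson List.finite_set card_mono empty_iff empty_subsetI finite_lin_indpt2 rev_finite_subset)
  then have "nc = card S"
    using rank_card_indpt[OF A(1)] A(2) by simp
  also have "\<dots> \<le> card (set (cols A))"
    using S by (intro card_mono) (auto simp: maximal_def)
  finally have "distinct (cols A)"
    using A(1) card_length[of "cols A"] by (intro card_distinct) auto
  then show False
    using lin_depI[OF A(1) v(1) \<open>v \<noteq> 0\<^sub>v nc\<close> v(2)] full_rank_lin_indpt[OF A] by blast
qed

lemma rank_transpose_eq_dim_row_space:
  "rank A\<^sup>T = vectorspace.dim class_ring (vs (row_space A))"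
  by (simp add: rank_def row_space_def)

lemma rank_le_n:
  assumes "A \<in> carrier_mat n nc"
  shows "rank A \<le> n"
proof -
  have "set (cols A) \<subseteq> carrier_vec n"
    using assms cols_dim by blast
  then have "subspace class_ring (span (set (cols A))) V"
    by (intro span_is_subspace) auto
  then show ?thesis
    unfolding rank_def using subspace_dim[OF _ fin_dim fin_dim_span_cols[OF assms]] dim_is_n by simp
qed

section \<open>Separating a vector from a span by a linear functional\<close>

lemma span_scalar_prod_zero:
  assumes "B \<subseteq> carrier_vec n" "y \<in> carrier_vec n" "\<And>b. b \<in> B \<Longrightarrow> b \<bullet> y = 0" "v \<in> span B"
  shows "v \<bullet> y = 0"
proof -
  obtain a A where A: "v = lincomb a A" "finite A" "A \<subseteq> B"
    using in_spanE[OF assms(4)] by blast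
  have "lincomb a A \<bullet> y = (\<Sum>v\<in>A. (a v \<cdot>\<^sub>v v) \<bullet> y)"
    unfolding lincomb_def using A(3) assms(1,2) by (intro finsum_scalar_prod_sum) auto
  also have "\<dots> = 0"
  proof (intro sum.neutral ballI)
    fix x assume "x \<in> A"
    then have "x \<in> B" "x \<in> carrier_vec n"
      using A(3) assms(1) by auto
    then show "(a x \<cdot>\<^sub>v x) \<bullet> y = 0"
      using assms(2,3) by simp
  qed
  finally show ?thesis
    by (simp add: A(1))
qed

text \<open>Supplies the linear equations that cut out a row space. Induction on \<open>B\<close>:
  if the new vector \<open>b\<close> lies in \<open>span B\<close>, the functional for
  \<open>B\<close> already kills it; otherwise two functionals for \<open>B\<close> are
  combined.\<close>

lemma separating_functional:
  assumes "finite B" "B \<subseteq> carrier_vec n" "w \<in> carrier_vec n" "w \<notin> span B"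
  obtains y where "y \<in> carrier_vec n" "\<And>b. b \<in> span B \<Longrightarrow> b \<bullet> y = 0" "w \<bullet> y = 1"
proof -
  have "\<exists>y\<in>carrier_vec n. (\<forall>b\<in>B. b \<bullet> y = 0) \<and> w \<bullet> y = 1"
    using assms
  proof (induction B arbitrary: w rule: finite_induct)
    case empty
    then have "w \<noteq> 0\<^sub>v n"
      using span_empty by auto
    then obtain i where i: "i < n" "w $ i \<noteq> 0"
      using empty(2) by (metis carrier_vecD eq_vecI index_zero_vec)
    have "w \<bullet> (inverse (w $ i) \<cdot>\<^sub>v unit_vec n i) = 1"
      using i empty(2) by simp
    then show ?case by auto
  next
    case (insert b B)
    have b: "b \<in> carrier_vec n" and B: "B \<subseteq> carrier_vec n"
      using insert.prems by auto
    have mono: "span B \<subseteq> span (insert b B)"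
      by (rule span_is_monotone) auto
    show ?case
    proof (cases "b \<in> span B")
      case True
      obtain y where y: "y \<in> carrier_vec n" "\<forall>b\<in>B. b \<bullet> y = 0" "w \<bullet> y = 1"
        using insert.IH[OF B insert.prems(2)] insert.prems(3) mono by blast
      have "b \<bullet> y = 0"
        using span_scalar_prod_zero[OF B y(1) _ True] y(2) by blast
      with y show ?thesis by auto
    next
      case False
      obtain y\<^sub>1 where y\<^sub>1: "y\<^sub>1 \<in> carrier_vec n" "\<forall>b\<in>B. b \<bullet> y\<^sub>1 = 0" "b \<bullet> y\<^sub>1 = 1"
        using insert.IH[OF B b False] by blast
      \<comment> \<open>The multiple of \<open>b\<close> is chosen so that
        \<open>u \<bullet> y\<^sub>1 = 0\<close>. As \<open>u\<close> differs from \<open>w\<close>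
        by a multiple of \<open>b\<close>, it stays outside \<open>span B\<close>.\<close>
      define u where "u = w - (w \<bullet> y\<^sub>1) \<cdot>\<^sub>v b"
      have u: "u \<in> carrier_vec n"
        using insert.prems b by (simp add: u_def)
      have "u \<notin> span B"
      proof
        assume "u \<in> span B"
        then have "u \<in> span (insert b B)"
          using mono by blast
        moreover have "(w \<bullet> y\<^sub>1) \<cdot>\<^sub>v b \<in> span (insert b B)"
          using insert.prems(1) by (intro smult_in_span span_mem) auto
        ultimately have "u + (w \<bullet> y\<^sub>1) \<cdot>\<^sub>v b \<in> span (insert b B)"
          using insert.prems(1) span_add1 by blast
        moreover have "u + (w \<bullet> y\<^sub>1) \<cdot>\<^sub>v b = w"
          using insert.prems(2) b by (intro eq_vecI) (auto simp: u_def)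
        ultimately show False
          using insert.prems(3) by simp
      qed
      then obtain y\<^sub>2 where y\<^sub>2: "y\<^sub>2 \<in> carrier_vec n" "\<forall>b\<in>B. b \<bullet> y\<^sub>2 = 0" "u \<bullet> y\<^sub>2 = 1"
        using insert.IH[OF B u] by blast
      \<comment> \<open>The correction makes \<open>b \<bullet> y\<close> vanish because
        \<open>b \<bullet> y\<^sub>1 = 1\<close>, and it turns \<open>w \<bullet> y\<close> into
        \<open>u \<bullet> y\<^sub>2\<close>.\<close>
      define y where "y = y\<^sub>2 - (b \<bullet> y\<^sub>2) \<cdot>\<^sub>v y\<^sub>1"
      have expand: "v \<bullet> y = v \<bullet> y\<^sub>2 - (b \<bullet> y\<^sub>2) * (v \<bullet> y\<^sub>1)" if "v \<in> carrier_vec n" for v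
        using that y\<^sub>1 y\<^sub>2 by (simp add: y_def scalar_prod_minus_distrib)
      have "w \<bullet> y\<^sub>2 - (w \<bullet> y\<^sub>1) * (b \<bullet> y\<^sub>2) = 1"
        using y\<^sub>2(1,3) insert.prems(2) b
        by (simp add: u_def minus_scalar_prod_distrib)
      then have "w \<bullet> y = 1"
        using insert.prems(2) by (simp add: expand mult.commute)
      moreover have "\<forall>v\<in>insert b B. v \<bullet> y = 0"
        using y\<^sub>1 y\<^sub>2 b B by (auto simp: expand)
      moreover have "y \<in> carrier_vec n"
        using y\<^sub>1 y\<^sub>2 by (simp add: y_def)
      ultimately show ?thesis by blast
    qed
  qed
  then obtain y where y: "y \<in> carrier_vec n" "\<forall>b\<in>B. b \<bullet> y = 0" "w \<bullet> y = 1"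
    by blast
  show ?thesis
    by (rule that[OF y(1) _ y(3)], rule span_scalar_prod_zero[OF assms(2) y(1)]) (use y(2) in auto)
qed

text \<open>Every row of \<open>C\<close> is a combination of the rows of \<open>B\<close>; the
  coefficient vectors form the rows of \<open>G\<close>. This is the change of basis used to compare
  minors.\<close>

lemma row_space_subset_imp_factor:
  assumes C: "C \<in> carrier_mat k n" and B: "B \<in> carrier_mat l n"
    and sub: "row_space C \<subseteq> row_space B"
  obtains G where "G \<in> carrier_mat k l" "C = G * B"
proof -
  have "\<exists>y\<in>carrier_vec l. B\<^sup>T *\<^sub>v y = row C i" if "i < k" for i
  proof -
    have "row C i \<in> set (rows C)"
      using that C by (auto simp: rows_def)
    moreover have "set (rows C) \<subseteq> carrier_vec n"
      using C by (auto simp: rows_def)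
    ultimately have "row C i \<in> row_space C"
      unfolding row_space_def by (intro span_mem) auto
    then have "row C i \<in> row_space B"
      using sub by (rule rev_subsetD)
    then show ?thesis
      using B by (auto simp: row_space_eq[OF B])
  qed
  then obtain y where y: "\<And>i. i < k \<Longrightarrow> y i \<in> carrier_vec l \<and> B\<^sup>T *\<^sub>v y i = row C i"
    by metis
  let ?G = "mat k l (\<lambda>(i, j). y i $ j)"
  have "C = ?G * B"
  proof (rule eq_matI)
    fix i j assume "i < dim_row (?G * B)" "j < dim_col (?G * B)"
    then have ij: "i < k" "j < n"
      using B by auto
    have "C $$ (i, j) = row C i $ j"
      using C ij by simp
    also have "\<dots> = (B\<^sup>T *\<^sub>v y i) $ j"
      using y ij by simp
    also have "\<dots> = col B j \<bullet> y i"
      using B ij by simp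
    also have "\<dots> = row ?G i \<bullet> col B j"
      using B y[OF ij(1)] ij by (auto simp: scalar_prod_def mult.commute intro!: sum.cong)
    finally show "C $$ (i, j) = (?G * B) $$ (i, j)"
      using B ij by simp
  qed (use B C in auto)
  then show ?thesis
    using that[of ?G] by simp
qed

end

section \<open>Linear spaces are Zariski closed\<close>

lemma mem_proj_point: "v \<in> proj_point v"
  unfolding proj_point_def by (intro CollectI exI[of _ 1]) simp

lemma proj_point_smult:
  assumes "c \<noteq> 0"
  shows "proj_point (c \<cdot>\<^sub>v v) = proj_point v"
proof (intro Set.set_eqI iffI)
  fix w assume "w \<in> proj_point v"
  then obtain d where "d \<noteq> 0" "w = d \<cdot>\<^sub>v v"
    by (auto simp: proj_point_def)
  then show "w \<in> proj_point (c \<cdot>\<^sub>v v)"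
    using assms by (auto simp: proj_point_def smult_smult_assoc intro!: exI[of _ "d / c"])
next
  fix w assume "w \<in> proj_point (c \<cdot>\<^sub>v v)"
  then obtain d where "d \<noteq> 0" "w = d \<cdot>\<^sub>v (c \<cdot>\<^sub>v v)"
    by (auto simp: proj_point_def)
  then show "w \<in> proj_point v"
    using assms by (auto simp: proj_point_def smult_smult_assoc intro!: exI[of _ "d * c"])
qed

text \<open>Representatives of a point differ by nonzero scalars and \<open>W\<close> is closed
  under scaling, so the choice of representative is irrelevant.\<close>

lemma proj_point_mem_projectivization:
  assumes "subspace class_ring W (module_vec TYPE(complex) (Suc n))"
  shows "proj_point v \<in> projectivization n W \<longleftrightarrow> v \<in> W \<and> v \<noteq> 0\<^sub>v (Suc n)"
proof
  note W = vec_space.subspaceD[OF assms]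
  assume "proj_point v \<in> projectivization n W"
  then obtain w where w: "w \<in> W" "w \<noteq> 0\<^sub>v (Suc n)" "proj_point v = proj_point w"
    by (auto simp: projectivization_def)
  then have "v \<in> proj_point w"
    using mem_proj_point by metis
  then obtain c where c: "c \<noteq> 0" "v = c \<cdot>\<^sub>v w"
    by (auto simp: proj_point_def)
  moreover have "w \<in> carrier_vec (Suc n)"
    using W(1) w(1) by blast
  ultimately have "w = inverse c \<cdot>\<^sub>v v"
    by (simp add: smult_smult_assoc)
  then have "v \<noteq> 0\<^sub>v (Suc n)"
    using w(2) by auto
  then show "v \<in> W \<and> v \<noteq> 0\<^sub>v (Suc n)"
    using W(3)[OF w(1)] c by simp
qed (auto simp: projectivization_def)

text \<open>The points determine the nonzero vectors of the subspace, and 0 lies in every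
  subspace.\<close>

lemma projectivization_inject:
  assumes "subspace class_ring W (module_vec TYPE(complex) (Suc n))"
    and "subspace class_ring W' (module_vec TYPE(complex) (Suc n))"
    and "projectivization n W = projectivization n W'"
  shows "W = W'"
proof (intro Set.set_eqI)
  fix v
  show "v \<in> W \<longleftrightarrow> v \<in> W'"
    using proj_point_mem_projectivization[OF assms(1), of v]
      proj_point_mem_projectivization[OF assms(2), of v] assms(3)
      vec_space.subspaceD(2)[OF assms(1)] vec_space.subspaceD(2)[OF assms(2)]
    by (cases "v = 0\<^sub>v (Suc n)") auto
qed

section \<open>Linear forms as homogeneous polynomials\<close>

definition linear_mpoly :: "nat \<Rightarrow> complex vec \<Rightarrow> mpoly" where
  "linear_mpoly n y = (\<Sum>j\<le>n. Poly_Mapping.single (Poly_Mapping.single j 1) (y $ j))"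

lemma keys_linear_mpoly:
  "Poly_Mapping.keys (linear_mpoly n y) \<subseteq> (\<lambda>j. Poly_Mapping.single j 1) ` {..n}"
  unfolding linear_mpoly_def by (rule order_trans[OF keys_sum]) auto

lemma homogeneous_linear_mpoly: "homogeneous n (linear_mpoly n y)"
proof -
  have "\<exists>j\<le>n. m = Poly_Mapping.single j 1" if "m \<in> Poly_Mapping.keys (linear_mpoly n y)" for m
    using keys_linear_mpoly that by blast
  then show ?thesis
    unfolding homogeneous_def by (intro conjI ballI exI[of _ 1]) fastforce+
qed

lemma mpoly_eval_linear_mpoly: "mpoly_eval (linear_mpoly n y) v = (\<Sum>j\<le>n. y $ j * v $ j)"
proof -
  let ?e = "\<lambda>j. Poly_Mapping.single j (1::nat)"
  let ?t = "\<lambda>m. Poly_Mapping.lookup (linear_mpoly n y) m *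
    (\<Prod>j\<in>Poly_Mapping.keys m. (v $ j) ^ Poly_Mapping.lookup m j)"
  have inj: "?e i = ?e j \<longleftrightarrow> i = j" for i j
    by (metis keys_single one_neq_zero singleton_inject)
  have lookup: "Poly_Mapping.lookup (linear_mpoly n y) (?e j) = y $ j" if "j \<le> n" for j
    unfolding linear_mpoly_def lookup_sum lookup_single inj
    using that by (simp add: when_def)
  \<comment> \<open>Variables with coefficient 0 are not among the keys; the sum is extended to all
    variables by zero terms.\<close>
  have "mpoly_eval (linear_mpoly n y) v = sum ?t (?e ` {..n})"
    unfolding mpoly_eval_def
    by (rule sum.mono_neutral_left[OF _ keys_linear_mpoly]) (auto simp: in_keys_iff)
  also have "\<dots> = (\<Sum>j\<le>n. ?t (?e j))"
    by (subst sum.reindex) (auto intro: inj_onI dest: iffD1[OF inj] simp del: One_nat_def)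
  also have "\<dots> = (\<Sum>j\<le>n. y $ j * v $ j)"
    by (intro sum.cong) (simp_all add: lookup del: One_nat_def)
  finally show ?thesis .
qed

text \<open>The equations are all linear forms vanishing on the row space. A vector outside the row
  space violates one of them by \<open>separating_functional\<close>.\<close>

lemma zariski_closed_proj_rowspan:
  assumes A: "A \<in> carrier_mat k (Suc n)"
  shows "zariski_closed n (proj_rowspan n A)"
proof -
  let ?W = "vec_space.row_space (Suc n) A"
  have sub: "subspace class_ring ?W (module_vec TYPE(complex) (Suc n))"
    by (rule vec_space.subspace_row_space[OF A])
  note W = vec_space.subspaceD[OF sub]
  define S where "S = {linear_mpoly n y | y. y \<in> carrier_vec (Suc n) \<and> (\<forall>b\<in>?W. b \<bullet> y = 0)}"
  have eval: "mpoly_eval (linear_mpoly n y) v = v \<bullet> y"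
    if "v \<in> carrier_vec (Suc n)" "y \<in> carrier_vec (Suc n)" for v y
    using that by (simp add: mpoly_eval_linear_mpoly scalar_prod_def atLeast0LessThan
        lessThan_Suc_atMost mult.commute)
  have "projectivization n ?W = {p \<in> proj_space n. \<forall>F\<in>S. \<forall>v\<in>p. mpoly_eval F v = 0}" (is "_ = ?Z")
  proof (intro equalityI subsetI)
    fix p assume "p \<in> projectivization n ?W"
    then obtain v where v: "p = proj_point v" "v \<in> ?W" "v \<noteq> 0\<^sub>v (Suc n)"
      by (auto simp: projectivization_def)
    then have "p \<in> proj_space n"
      using W(1) by (auto simp: proj_space_def projectivization_def)
    moreover have "mpoly_eval F u = 0" if F: "F \<in> S" and u: "u \<in> p" for F u
    proof -
      have "u \<in> ?W"
        using u v W(3) by (auto simp: proj_point_def)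
      moreover obtain y where "F = linear_mpoly n y" "y \<in> carrier_vec (Suc n)" "\<forall>b\<in>?W. b \<bullet> y = 0"
        using F by (auto simp: S_def)
      ultimately show ?thesis
        using W(1) eval by auto
    qed
    ultimately show "p \<in> ?Z" by blast
  next
    fix p assume p: "p \<in> ?Z"
    then obtain v where v: "p = proj_point v" "v \<in> carrier_vec (Suc n)" "v \<noteq> 0\<^sub>v (Suc n)"
      by (auto simp: proj_space_def projectivization_def)
    have "v \<in> ?W"
    proof (rule ccontr)
      assume notin: "v \<notin> ?W"
      have "set (rows A) \<subseteq> carrier_vec (Suc n)"
        using A by (auto simp: rows_def)
      then obtain y where y: "y \<in> carrier_vec (Suc n)" "\<And>b. b \<in> ?W \<Longrightarrow> b \<bullet> y = 0" "v \<bullet> y = 1"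
        using vec_space.separating_functional[of "set (rows A)" "Suc n" v] v(2) notin
        unfolding vec_space.row_space_def by blast
      have "linear_mpoly n y \<in> S"
        using y by (auto simp: S_def)
      then have "mpoly_eval (linear_mpoly n y) v = 0"
        using p v(1) mem_proj_point by auto
      then show False
        using eval[OF v(2) y(1)] y(3) by simp
    qed
    then show "p \<in> projectivization n ?W"
      using v by (auto simp: projectivization_def)
  qed
  moreover have "\<forall>F\<in>S. homogeneous n F"
    by (auto simp: S_def homogeneous_linear_mpoly)
  ultimately show ?thesis
    unfolding zariski_closed_def proj_rowspan_def by blast
qed

section \<open>Hadamard powers of a line\<close>

lemma power_matrix_carrier:
  "A \<in> carrier_mat k m \<Longrightarrow> power_matrix r A \<in> carrier_mat (Suc r) m"
  by (simp add: power_matrix_def)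

lemma power_matrix_1:
  assumes "A \<in> carrier_mat 2 m"
  shows "power_matrix 1 A = A"
  using assms by (intro eq_matI) (auto simp: power_matrix_def less_2_cases_iff)

text \<open>Combining the rows with coefficients \<open>c s\<close> gives, in position
  \<open>i\<close>, the form with these coefficients evaluated at the \<open>i\<close>-th column of
  \<open>A\<close>.\<close>

lemma row_space_power_matrix:
  assumes A: "A \<in> carrier_mat k (Suc n)"
  shows "vec_space.row_space (Suc n) (power_matrix r A) =
    {vec (Suc n) (\<lambda>i. binary_form r c (A $$ (0, i)) (A $$ (1, i))) | c. True}"
proof -
  note B = power_matrix_carrier[OF A, of r]
  have mult: "(power_matrix r A)\<^sup>T *\<^sub>v y =
      vec (Suc n) (\<lambda>i. binary_form r (($) y) (A $$ (0, i)) (A $$ (1, i)))"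
    if "y \<in> carrier_vec (Suc r)" for y
    using A that
    by (intro eq_vecI) (auto simp: binary_form_def power_matrix_def scalar_prod_def
        atLeast0LessThan lessThan_Suc_atMost mult.commute simp del: sum.lessThan_Suc intro!: sum.cong)
  show ?thesis
  proof (intro equalityI subsetI)
    fix w assume "w \<in> vec_space.row_space (Suc n) (power_matrix r A)"
    then obtain y where "y \<in> carrier_vec (Suc r)" "(power_matrix r A)\<^sup>T *\<^sub>v y = w"
      using B by (auto simp: vec_space.row_space_eq[OF B])
    then show "w \<in> {vec (Suc n) (\<lambda>i. binary_form r c (A $$ (0, i)) (A $$ (1, i))) | c. True}"
      using mult by blast
  next
    fix w assume "w \<in> {vec (Suc n) (\<lambda>i. binary_form r c (A $$ (0, i)) (A $$ (1, i))) | c. True}"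
    then obtain c where w: "w = vec (Suc n) (\<lambda>i. binary_form r c (A $$ (0, i)) (A $$ (1, i)))"
      by blast
    \<comment> \<open>Truncating \<open>c\<close> to \<open>vec (Suc r) c\<close> keeps all the
      coefficients that enter the form.\<close>
    have "(power_matrix r A)\<^sup>T *\<^sub>v vec (Suc r) c = w"
      unfolding w by (subst mult) (auto simp: binary_form_def)
    then show "w \<in> vec_space.row_space (Suc n) (power_matrix r A)"
      using B w by (auto simp: vec_space.row_space_eq[OF B] intro!: bexI[of _ "vec (Suc r) c"])
  qed
qed

text \<open>Entrywise products of vectors correspond to products of forms. One inclusion multiplies
  a linear form by a form of degree \<open>r\<close>, the other splits a form of degree
  \<open>Suc r\<close>.\<close>

lemma hadamard_product_proj_rowspan:
  assumes A: "A \<in> carrier_mat 2 (Suc n)"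
  shows "hadamard_product n (proj_rowspan n A) (proj_rowspan n (power_matrix r A)) =
    proj_rowspan n (power_matrix (Suc r) A)"
proof -
  let ?W = "\<lambda>r. vec_space.row_space (Suc n) (power_matrix r A)"
  let ?v = "\<lambda>r c. vec (Suc n) (\<lambda>i. binary_form r c (A $$ (0, i)) (A $$ (1, i)))"
  note W = row_space_power_matrix[OF A]
  have sub: "subspace class_ring (?W r) (module_vec TYPE(complex) (Suc n))" for r
    by (rule vec_space.subspace_row_space[OF power_matrix_carrier[OF A]])
  have mem: "proj_point u \<in> proj_rowspan n (power_matrix r A) \<longleftrightarrow> u \<in> ?W r \<and> u \<noteq> 0\<^sub>v (Suc n)" for u r
    unfolding proj_rowspan_def by (rule proj_point_mem_projectivization[OF sub])
  \<comment> \<open>The description of row spaces by forms thus applies to the first factor too,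
    with degree 1.\<close>
  have A1: "proj_rowspan n A = proj_rowspan n (power_matrix 1 A)"
    by (simp only: power_matrix_1[OF A])
  have "{proj_point (component_mult u v) | u v. proj_point u \<in> proj_rowspan n A \<and>
      proj_point v \<in> proj_rowspan n (power_matrix r A) \<and> (\<exists>i\<le>n. u $ i * v $ i \<noteq> 0)} =
    proj_rowspan n (power_matrix (Suc r) A)" (is "?H = _")
  proof (intro equalityI subsetI)
    fix p assume "p \<in> ?H"
    then obtain u v c d where p: "p = proj_point (component_mult u v)"
      and uv: "u = ?v 1 c" "v = ?v r d" and ne: "\<exists>i\<le>n. u $ i * v $ i \<noteq> 0"
      unfolding A1 mem W by blast
    have "component_mult u v =
        vec (Suc n) (\<lambda>i. (c 0 * A $$ (0, i) + c 1 * A $$ (1, i)) * binary_form r d (A $$ (0, i)) (A $$ (1, i)))"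
      by (intro eq_vecI) (auto simp: component_mult_def uv binary_form_def[of "Suc 0"])
    also have "\<dots> \<in> ?W (Suc r)"
      unfolding W binary_form_linear_mult by blast
    finally have "component_mult u v \<in> ?W (Suc r)" .
    \<comment> \<open>The condition that the product is defined supplies a nonzero
      coordinate.\<close>
    moreover have "component_mult u v \<noteq> 0\<^sub>v (Suc n)"
    proof
      assume eq: "component_mult u v = 0\<^sub>v (Suc n)"
      obtain i where i: "i \<le> n" "u $ i * v $ i \<noteq> 0"
        using ne by blast
      have "component_mult u v $ i = u $ i * v $ i"
        using i(1) by (simp add: uv component_mult_def)
      then show False
        using i by (simp add: eq)
    qed
    ultimately show "p \<in> proj_rowspan n (power_matrix (Suc r) A)"
      unfolding p mem by blast
  next
    fix p assume "p \<in> proj_rowspan n (power_matrix (Suc r) A)"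
    then obtain w where w: "p = proj_point w" "w \<in> ?W (Suc r)" "w \<noteq> 0\<^sub>v (Suc n)"
      by (auto simp: proj_rowspan_def projectivization_def)
    then obtain c where c: "w = ?v (Suc r) c"
      unfolding W by blast
    obtain \<alpha> \<beta> d where split:
      "\<And>x y. binary_form (Suc r) c x y = (\<alpha> * x + \<beta> * y) * binary_form r d x y"
      using binary_form_split_linear by blast
    define u where "u = ?v 1 (\<lambda>s. if s = 0 then \<alpha> else \<beta>)"
    define v where "v = ?v r d"
    have w_eq: "w = component_mult u v"
      by (intro eq_vecI) (auto simp: c split u_def v_def component_mult_def binary_form_def[of "Suc 0"])
    have w_index: "w $ i = u $ i * v $ i" if "i \<le> n" for i
      unfolding w_eq using that by (simp add: component_mult_def u_def v_def)
    have "dim_vec w = Suc n"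
      by (simp add: c)
    \<comment> \<open>A nonzero coordinate of \<open>w\<close> shows at once that both factors are
      nonzero vectors and that their product is defined.\<close>
    then obtain i where i: "i \<le> n" "w $ i \<noteq> 0"
      using w(3) by (metis eq_vecI index_zero_vec less_Suc_eq_le)
    then have "u $ i \<noteq> 0" "v $ i \<noteq> 0"
      using w_index by auto
    then have "u \<noteq> 0\<^sub>v (Suc n)" "v \<noteq> 0\<^sub>v (Suc n)"
      using i(1) by auto
    moreover have "u \<in> ?W 1" "v \<in> ?W r"
      unfolding W u_def v_def by blast+
    ultimately show "p \<in> ?H"
      unfolding A1 mem using w(1) w_eq w_index i by auto
  qed
  \<comment> \<open>The set of products is itself closed, so taking the closure adds
    nothing.\<close>
  then show ?thesis
    unfolding hadamard_product_def zariski_closure_def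
    using hull_same[of "zariski_closed n", OF zariski_closed_proj_rowspan[OF power_matrix_carrier[OF A]]]
    by simp
qed

lemma hadamard_power_proj_rowspan:
  assumes A: "A \<in> carrier_mat 2 (Suc n)"
  shows "hadamard_power n (proj_rowspan n A) r = proj_rowspan n (power_matrix r A)"
proof (induction r)
  case 0
  let ?one = "vec (Suc n) (\<lambda>_. 1 :: complex)"
  \<comment> \<open>Forms of degree 0 are constants, also at columns with zero entries because
    \<open>0 ^ 0 = 1\<close>.\<close>
  have W: "vec_space.row_space (Suc n) (power_matrix 0 A) = {a \<cdot>\<^sub>v ?one | a. True}"
    unfolding row_space_power_matrix[OF A]
  proof (intro Set.set_eqI iffI; clarify)
    fix c :: "nat \<Rightarrow> complex"
    show "\<exists>a. vec (Suc n) (\<lambda>i. binary_form 0 c (A $$ (0, i)) (A $$ (1, i))) = a \<cdot>\<^sub>v ?one \<and> True"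
      by (intro exI[of _ "c 0"] conjI eq_vecI) (auto simp: binary_form_def)
  next
    fix a
    show "\<exists>c. a \<cdot>\<^sub>v ?one = vec (Suc n) (\<lambda>i. binary_form 0 c (A $$ (0, i)) (A $$ (1, i))) \<and> True"
      by (intro exI[of _ "\<lambda>_. a"] conjI eq_vecI) (auto simp: binary_form_def)
  qed
  have nonzero: "a \<cdot>\<^sub>v ?one \<noteq> 0\<^sub>v (Suc n) \<longleftrightarrow> a \<noteq> 0" for a
  proof
    assume "a \<cdot>\<^sub>v ?one \<noteq> 0\<^sub>v (Suc n)" then show "a \<noteq> 0" by auto
  next
    assume "a \<noteq> 0"
    then have "(a \<cdot>\<^sub>v ?one) $ 0 \<noteq> 0\<^sub>v (Suc n) $ 0" by simp
    then show "a \<cdot>\<^sub>v ?one \<noteq> 0\<^sub>v (Suc n)" by metis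
  qed
  have "proj_rowspan n (power_matrix 0 A) = {proj_point (a \<cdot>\<^sub>v ?one) | a. a \<noteq> 0}"
    unfolding proj_rowspan_def projectivization_def W using nonzero by blast
  also have "\<dots> = {proj_point ?one}"
    by (auto simp: proj_point_smult intro: exI[of _ 1])
  finally show ?case by simp
next
  case (Suc r)
  then show ?case
    by (simp add: hadamard_product_proj_rowspan[OF A])
qed

section \<open>Maximal minors\<close>

lemma index_list_nth_le:
  assumes "ix \<in> index_lists n d" "k \<le> d"
  shows "ix ! k \<le> n"
proof -
  have "ix ! k \<in> set ix"
    using assms by (auto simp: index_lists_def)
  then show ?thesis
    using assms(1) by (auto simp: index_lists_def)
qed

lemma upt_mem_index_lists: "d \<le> n \<Longrightarrow> [0..<Suc d] \<in> index_lists n d"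
  by (auto simp: index_lists_def simp del: upt_Suc)

text \<open>Selecting columns of a power matrix gives the homogeneous Vandermonde matrix of the
  selected columns of \<open>A\<close>. Only bounds on the entries of \<open>ix\<close> are assumed,
  so that pairs \<open>[a, b]\<close> in any order are covered.\<close>

lemma maximal_minor_power_matrix:
  assumes A: "A \<in> carrier_mat k (Suc n)" and ix: "length ix = Suc r" "\<And>k. k \<le> r \<Longrightarrow> ix ! k \<le> n"
  shows "maximal_minor (power_matrix r A) ix =
    (\<Prod>(j, k) \<in> {(j, k). j < k \<and> k \<le> r}.
      A $$ (0, ix ! j) * A $$ (1, ix ! k) - A $$ (0, ix ! k) * A $$ (1, ix ! j))"
proof -
  have "mat (Suc r) (Suc r) (\<lambda>(s, k). power_matrix r A $$ (s, ix ! k)) =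
      mat (Suc r) (Suc r) (\<lambda>(s, k). A $$ (0, ix ! k) ^ (r - s) * A $$ (1, ix ! k) ^ s)"
    using A ix(2) by (intro cong_mat) (auto simp: power_matrix_def less_Suc_eq_le)
  then show ?thesis
    using det_homogeneous_vandermonde[of r "\<lambda>k. A $$ (0, ix ! k)" "\<lambda>k. A $$ (1, ix ! k)"]
    by (simp add: maximal_minor_def ix(1) power_matrix_def)
qed

lemma maximal_minor_2:
  assumes A: "A \<in> carrier_mat 2 (Suc n)" and "a \<le> n" "b \<le> n"
  shows "maximal_minor A [a, b] = A $$ (0, a) * A $$ (1, b) - A $$ (0, b) * A $$ (1, a)"
proof -
  have "{(j, k). j < k \<and> k \<le> 1} = {(0 :: nat, 1 :: nat)}" by auto
  then show ?thesis
    using maximal_minor_power_matrix[OF A, of "[a, b]" 1] assms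
    by (simp add: power_matrix_1[OF A] nth_Cons' del: One_nat_def)
qed

lemma maximal_minor_power_matrix_eq_prod:
  assumes A: "A \<in> carrier_mat 2 (Suc n)" and ix: "ix \<in> index_lists n r"
  shows "maximal_minor (power_matrix r A) ix =
    (\<Prod>(j, k) \<in> {(j, k). j < k \<and> k \<le> r}. maximal_minor A [ix ! j, ix ! k])"
proof -
  have "length ix = Suc r"
    using ix by (simp add: index_lists_def)
  then have "maximal_minor (power_matrix r A) ix = (\<Prod>(j, k) \<in> {(j, k). j < k \<and> k \<le> r}.
      A $$ (0, ix ! j) * A $$ (1, ix ! k) - A $$ (0, ix ! k) * A $$ (1, ix ! j))"
    using index_list_nth_le[OF ix] by (rule maximal_minor_power_matrix[OF A])
  also have "\<dots> = (\<Prod>(j, k) \<in> {(j, k). j < k \<and> k \<le> r}. maximal_minor A [ix ! j, ix ! k])"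
    by (intro prod.cong) (auto simp: maximal_minor_2[OF A] index_list_nth_le[OF ix])
  finally show ?thesis .
qed

section \<open>Minors, change of basis and rank\<close>

lemma maximal_minor_mult:
  assumes G: "G \<in> carrier_mat k k" and B: "B \<in> carrier_mat k m"
    and ix: "length ix = k" "set ix \<subseteq> {..<m}"
  shows "maximal_minor (G * B) ix = det G * maximal_minor B ix"
proof -
  have "ix ! j < m" if "j < k" for j
    using ix that nth_mem by fastforce
  \<comment> \<open>Selecting columns commutes with multiplication from the left.\<close>
  then have "mat k k (\<lambda>(s, j). (G * B) $$ (s, ix ! j)) = G * mat k k (\<lambda>(s, j). B $$ (s, ix ! j))"
    using G B by (intro eq_matI) (auto simp: scalar_prod_def intro!: sum.cong)
  then show ?thesis
    using G B det_mult[OF G, of "mat k k (\<lambda>(s, j). B $$ (s, ix ! j))"]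
    by (simp add: maximal_minor_def ix(1))
qed

text \<open>The selected columns are \<open>n\<close> distinct independent columns of
  \<open>B\<close>, and the rank cannot exceed the number \<open>n\<close> of rows.\<close>

lemma (in vec_space) rank_eq_n_of_maximal_minor:
  assumes B: "B \<in> carrier_mat n m" and ix: "length ix = n" "set ix \<subseteq> {..<m}"
    and minor: "det (mat n n (\<lambda>(s, k). B $$ (s, ix ! k))) \<noteq> 0"
  shows "rank B = n"
proof -
  let ?M = "mat n n (\<lambda>(s, k). B $$ (s, ix ! k))"
  have M: "?M \<in> carrier_mat n n" by simp
  have full: "rank ?M = n"
    using low_rank_det_zero[OF M minor] .
  then have dist: "distinct (cols ?M)"
    using non_distinct_low_rank[OF M] by fastforce
  have "ix ! j < m" if "j < n" for j
    using ix that nth_mem by fastforce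
  moreover have "col ?M j = col B (ix ! j)" if "j < n" for j
    using that B calculation[OF that] by (intro eq_vecI) auto
  ultimately have "set (cols ?M) \<subseteq> set (cols B)"
    using B by (auto simp: cols_def)
  then have "card (set (cols ?M)) \<le> rank B"
    using rank_ge_card_indpt[OF B _ full_rank_lin_indpt[OF M full dist]] by blast
  moreover have "card (set (cols ?M)) = n"
    using distinct_card[OF dist] by simp
  ultimately show ?thesis
    using rank_le_n[OF B] by simp
qed

text \<open>A relation between the rows of \<open>B\<close> restricts to the selected columns, where
  the square matrix is invertible; so it is trivial. This gives the dimension of the row
  space.\<close>

lemma (in vec_space) rank_transpose_of_maximal_minor:
  assumes B: "B \<in> carrier_mat k n" and ix: "length ix = k" "set ix \<subseteq> {..<n}"
    and minor: "det (mat k k (\<lambda>(s, j). B $$ (s, ix ! j))) \<noteq> 0"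
  shows "rank B\<^sup>T = k"
proof -
  let ?M = "mat k k (\<lambda>(s, j). B $$ (s, ix ! j))"
  have BT: "B\<^sup>T \<in> carrier_mat n k"
    using B by simp
  have ix_less: "ix ! j < n" if "j < k" for j
    using ix that nth_mem by fastforce
  have kernel: "v = 0\<^sub>v k" if v: "v \<in> carrier_vec k" "B\<^sup>T *\<^sub>v v = 0\<^sub>v n" for v
  proof -
    have "?M\<^sup>T *\<^sub>v v = 0\<^sub>v k"
    proof (rule eq_vecI)
      fix j assume "j < dim_vec (0\<^sub>v k :: 'a vec)"
      then have j: "j < k" by simp
      have "(?M\<^sup>T *\<^sub>v v) $ j = (B\<^sup>T *\<^sub>v v) $ (ix ! j)"
        using B v(1) j ix_less[OF j] by (auto simp: scalar_prod_def intro!: sum.cong)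
      then show "(?M\<^sup>T *\<^sub>v v) $ j = 0\<^sub>v k $ j"
        using v(2) ix_less[OF j] j by simp
    qed simp
    moreover have "det ?M\<^sup>T \<noteq> 0"
      using minor det_transpose[of ?M k] by simp
    ultimately show ?thesis
      using det_0_iff_vec_prod_zero_field[of "?M\<^sup>T" k] v(1) by auto
  qed
  \<comment> \<open>Equal rows of \<open>B\<close> would give \<open>?M\<close> two equal rows.
    Distinctness is needed to count the columns of the transpose as a set.\<close>
  have "distinct (cols B\<^sup>T)"
    unfolding distinct_conv_nth
  proof (intro allI impI notI)
    fix i j assume ij: "i < length (cols B\<^sup>T)" "j < length (cols B\<^sup>T)" "i \<noteq> j"
      "cols B\<^sup>T ! i = cols B\<^sup>T ! j"
    then have "i < k" "j < k" "row B i = row B j"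
      using B by auto
    then have "row ?M i = row ?M j"
    proof (intro eq_vecI)
      fix l assume "l < dim_vec (row ?M j)"
      then have "l < k" by simp
      have "row B i $ (ix ! l) = row B j $ (ix ! l)"
        using \<open>row B i = row B j\<close> by simp
      then show "row ?M i $ l = row ?M j $ l"
        using B ix_less \<open>i < k\<close> \<open>j < k\<close> \<open>l < k\<close> by simp
    qed simp
    then show False
      using det_identical_rows[of ?M k i j] minor ij(3) \<open>i < k\<close> \<open>j < k\<close> by simp
  qed
  moreover from this have "lin_indpt (set (cols B\<^sup>T))"
    using lin_depE[OF BT] kernel by metis
  ultimately show ?thesis
    using lin_indpt_full_rank[OF BT] by blast
qed

text \<open>Plucker coordinates are well defined up to a scalar: equal row spaces give
  \<open>C = G * B\<close> and \<open>B = H * C\<close>, and \<open>c\<close> is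
  \<open>det G\<close>. It is nonzero because the minor of \<open>B\<close> at
  \<open>ix\<^sub>0\<close> is a multiple of that of \<open>C\<close>, which is \<open>det G\<close>
  times a minor of \<open>B\<close>.\<close>

lemma proj_rowspan_eq_imp_minors:
  assumes B: "B \<in> carrier_mat (Suc d) (Suc n)" and C: "C \<in> carrier_mat (Suc d) (Suc n)"
    and eq: "proj_rowspan n C = proj_rowspan n B"
    and ix: "ix\<^sub>0 \<in> index_lists n d" "maximal_minor B ix\<^sub>0 \<noteq> 0"
  obtains c where "c \<noteq> 0" "\<And>ix. ix \<in> index_lists n d \<Longrightarrow> maximal_minor C ix = c * maximal_minor B ix"
proof -
  have W: "vec_space.row_space (Suc n) C = vec_space.row_space (Suc n) B"
    using eq unfolding proj_rowspan_def
    by (rule projectivization_inject[OF vec_space.subspace_row_space[OF C] vec_space.subspace_row_space[OF B]])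
  obtain G where G: "G \<in> carrier_mat (Suc d) (Suc d)" "C = G * B"
    using vec_space.row_space_subset_imp_factor[OF C B] W by blast
  obtain H where H: "H \<in> carrier_mat (Suc d) (Suc d)" "B = H * C"
    using vec_space.row_space_subset_imp_factor[OF B C] W by blast
  have ixD: "length ix = Suc d" "set ix \<subseteq> {..<Suc n}" if "ix \<in> index_lists n d" for ix
    using that by (auto simp: index_lists_def)
  have minor_C: "maximal_minor C ix = det G * maximal_minor B ix" if "ix \<in> index_lists n d" for ix
    using maximal_minor_mult[OF G(1) B ixD[OF that]] G(2) by simp
  have "maximal_minor B ix\<^sub>0 = det H * maximal_minor C ix\<^sub>0"
    using maximal_minor_mult[OF H(1) C ixD[OF ix(1)]] H(2) by simp
  then have "det G \<noteq> 0"
    using minor_C[OF ix(1)] ix(2) by (metis mult_zero_left mult_zero_right)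
  then show ?thesis
    using minor_C by (rule that)
qed

section \<open>The minors of a line avoiding the coordinate strata\<close>

lemma row_space_of_proj_linear_space:
  assumes L: "proj_linear_space n d (proj_rowspan n A)" and A: "A \<in> carrier_mat k (Suc n)"
  shows "vectorspace.dim class_ring
    (module_vec TYPE(complex) (Suc n) \<lparr>carrier := vec_space.row_space (Suc n) A\<rparr>) = Suc d"
proof -
  obtain W where W: "subspace class_ring W (module_vec TYPE(complex) (Suc n))"
    "vectorspace.dim class_ring (module_vec TYPE(complex) (Suc n) \<lparr>carrier := W\<rparr>) = Suc d"
    "proj_rowspan n A = projectivization n W"
    using L by (auto simp: proj_linear_space_def)
  then have "W = vec_space.row_space (Suc n) A"
    using projectivization_inject[OF W(1) vec_space.subspace_row_space[OF A]]
    by (simp add: proj_rowspan_def)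
  then show ?thesis
    using W(2) by simp
qed

text \<open>If the minor vanished, a nontrivial combination \<open>w\<close> of the two rows would
  be zero at \<open>i\<close> and \<open>j\<close>. It would then have at most \<open>n - 1\<close>
  nonzero coordinates and define a point of the line in \<open>Delta n (n - 2)\<close>.\<close>

lemma line_minor_nonzero:
  assumes A: "A \<in> carrier_mat 2 (Suc n)" and L: "proj_linear_space n 1 (proj_rowspan n A)"
    and disj: "proj_rowspan n A \<inter> Delta n (n - 2) = {}"
    and ij: "i < j" "j \<le> n" and "n > 1"
  shows "maximal_minor A [i, j] \<noteq> 0"
proof
  assume minor: "maximal_minor A [i, j] = 0"
  let ?M = "mat 2 2 (\<lambda>(s, k). A $$ (s, [i, j] ! k))"
  have "det ?M\<^sup>T = 0"
    using minor A det_transpose[of ?M 2] by (simp add: maximal_minor_def numeral_2_eq_2)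
  then obtain y where y: "y \<in> carrier_vec 2" "y \<noteq> 0\<^sub>v 2" "?M\<^sup>T *\<^sub>v y = 0\<^sub>v 2"
    using det_0_iff_vec_prod_zero_field[of "?M\<^sup>T" 2] by auto
  define w where "w = A\<^sup>T *\<^sub>v y"
  have w: "w \<in> carrier_vec (Suc n)"
    unfolding w_def by (rule mult_mat_vec_carrier[OF _ y(1)]) (use A in simp)
  \<comment> \<open>A line has a row space of dimension 2, so the rows are independent and
    \<open>w\<close> is nonzero.\<close>
  have "vec_space.rank (Suc n) A\<^sup>T = 2"
    using row_space_of_proj_linear_space[OF L A]
    by (simp add: vec_space.rank_transpose_eq_dim_row_space)
  then have "w \<noteq> 0\<^sub>v (Suc n)"
    using vec_space.rank_eq_nc_imp_kernel_trivial[of "A\<^sup>T" "Suc n" 2 y] A y by (auto simp: w_def)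
  moreover have "w \<in> vec_space.row_space (Suc n) A"
    using A y(1) w by (auto simp: vec_space.row_space_eq[OF A] w_def)
  ultimately have "proj_point w \<in> proj_rowspan n A"
    by (auto simp: proj_rowspan_def projectivization_def)
  moreover have "proj_point w \<in> Delta n (n - 2)"
  proof -
    have "(?M\<^sup>T *\<^sub>v y) $ k = w $ ([i, j] ! k)" if "k < 2" for k
      using that A y(1) ij by (auto simp: w_def scalar_prod_def less_2_cases_iff intro!: sum.cong)
    from this[of 0] this[of 1] have zero: "w $ i = 0" "w $ j = 0"
      using y(3) by auto
    have "card {k. k \<le> n \<and> v $ k \<noteq> 0} \<le> n - 2 + 1" if v: "v \<in> proj_point w" for v
    proof -
      obtain c where "v = c \<cdot>\<^sub>v w"
        using v by (auto simp: proj_point_def)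
      then have "{k. k \<le> n \<and> v $ k \<noteq> 0} \<subseteq> {..n} - {i, j}"
        using w zero ij by auto
      then have "card {k. k \<le> n \<and> v $ k \<noteq> 0} \<le> card ({..n} - {i, j})"
        by (intro card_mono) auto
      \<comment> \<open>Two of the \<open>n + 1\<close> indices are removed; \<open>n > 1\<close>
        makes the truncated subtraction exact.\<close>
      also have "\<dots> = n - 2 + 1"
        using ij \<open>n > 1\<close> by (subst card_Diff_subset) auto
      finally show ?thesis .
    qed
    moreover have "proj_point w \<in> proj_space n"
      using w \<open>w \<noteq> 0\<^sub>v (Suc n)\<close> by (auto simp: proj_space_def projectivization_def)
    ultimately show ?thesis
      by (simp add: Delta_def)
  qed
  ultimately show False
    using disj by blast
qed

text \<open>Arbitrary full rank matrices determine Plucker tuples only up to a scalar, which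
  accounts for \<open>c\<close>; for \<open>A\<close> and \<open>power_matrix r A\<close> the
  equality is exact. The linearity and rank claims ensure that the minors are coordinates of an
  \<open>r\<close>-dimensional space.\<close>

theorem proposition3p6:
  fixes n r :: nat and L :: "complex vec set set"
  assumes "n > 1"
    and "proj_linear_space n 1 L"
    and "L \<inter> Delta n (n - 2) = {}"
    and "1 \<le> r" and "r < n"
  shows
    "(\<forall>A \<in> carrier_mat 2 (Suc n). L = proj_rowspan n A \<longrightarrow>
        hadamard_power n L r = proj_rowspan n (power_matrix r A)) \<and>
     proj_linear_space n r (hadamard_power n L r) \<and>
     (\<forall>P Q. plucker_coordinates n 1 L P \<and> plucker_coordinates n r (hadamard_power n L r) Q \<longrightarrow>
        (\<exists>c. c \<noteq> 0 \<and> (\<forall>ix \<in> index_lists n r.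
           Q ix = c * (\<Prod>(j, k) \<in> {(j, k). j < k \<and> k \<le> r}. P [ix ! j, ix ! k])))) \<and>
     (\<forall>A \<in> carrier_mat 2 (Suc n). L = proj_rowspan n A \<longrightarrow>
        vec_space.rank (Suc r) (power_matrix r A) = Suc r \<and>
        (\<forall>ix \<in> index_lists n r.
           maximal_minor (power_matrix r A) ix =
             (\<Prod>(j, k) \<in> {(j, k). j < k \<and> k \<le> r}. maximal_minor A [ix ! j, ix ! k])))"
proof -
  \<comment> \<open>The first \<open>Suc r\<close> columns serve as witness. The minor there is a
    product of nonzero minors of the line; it yields both rank claims and the nonzero scalar between
    Plucker tuples.\<close>
  let ?ix = "[0..<Suc r]"
  have ix0: "?ix \<in> index_lists n r"
    using \<open>r < n\<close> by (intro upt_mem_index_lists) simp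
  then have ix0D: "length ?ix = Suc r" "set ?ix \<subseteq> {..<Suc n}"
    by (auto simp: index_lists_def)
  have minor: "maximal_minor (power_matrix r A) ?ix \<noteq> 0"
    if A: "A \<in> carrier_mat 2 (Suc n)" "L = proj_rowspan n A" for A
  proof -
    have "maximal_minor A [?ix ! j, ?ix ! k] \<noteq> 0" if "j < k" "k \<le> r" for j k
      using line_minor_nonzero[OF A(1), of j k] assms A(2) that by (simp del: upt_Suc)
    moreover have "finite {(j, k). j < k \<and> k \<le> r}"
      by (rule finite_subset[of _ "{..r} \<times> {..r}"]) auto
    ultimately show ?thesis
      unfolding maximal_minor_power_matrix_eq_prod[OF A(1) ix0] by (auto simp del: upt_Suc)
  qed
  have det: "det (mat (Suc r) (Suc r) (\<lambda>(s, k). power_matrix r A $$ (s, ?ix ! k))) \<noteq> 0"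
    if A: "A \<in> carrier_mat 2 (Suc n)" "L = proj_rowspan n A" for A
    using minor[OF that] power_matrix_carrier[OF A(1), of r]
    by (simp add: maximal_minor_def del: upt_Suc)
  have power: "hadamard_power n L r = proj_rowspan n (power_matrix r A)"
    if "A \<in> carrier_mat 2 (Suc n)" "L = proj_rowspan n A" for A
    using that hadamard_power_proj_rowspan by simp
  have linear: "proj_linear_space n r (hadamard_power n L r)"
  proof -
    obtain W where W: "subspace class_ring W (module_vec TYPE(complex) (Suc n))"
      "vectorspace.dim class_ring (module_vec TYPE(complex) (Suc n) \<lparr>carrier := W\<rparr>) = Suc 1"
      "L = projectivization n W"
      using assms(2) by (auto simp: proj_linear_space_def)
    \<comment> \<open>A basis of the two-dimensional space under \<open>L\<close> supplies a matrix
      to which the preceding facts apply.\<close>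
    then obtain A where A: "A \<in> carrier_mat 2 (Suc n)" "L = proj_rowspan n A"
      using vec_space.subspace_eq_row_space[OF W(1)] unfolding proj_rowspan_def
      by (metis Suc_1)
    have "vec_space.rank (Suc n) (power_matrix r A)\<^sup>T = Suc r"
      using vec_space.rank_transpose_of_maximal_minor[OF power_matrix_carrier[OF A(1)] ix0D det[OF A]] .
    then show ?thesis
      using vec_space.subspace_row_space[OF power_matrix_carrier[OF A(1)], of r] power[OF A]
      by (auto simp: proj_linear_space_def proj_rowspan_def vec_space.rank_transpose_eq_dim_row_space)
  qed
  have plucker: "\<exists>c. c \<noteq> 0 \<and> (\<forall>ix \<in> index_lists n r.
      Q ix = c * (\<Prod>(j, k) \<in> {(j, k). j < k \<and> k \<le> r}. P [ix ! j, ix ! k]))"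
    if P: "plucker_coordinates n 1 L P" and Q: "plucker_coordinates n r (hadamard_power n L r) Q" for P Q
  proof -
    obtain A where A: "A \<in> carrier_mat 2 (Suc n)" "L = proj_rowspan n A" and P: "P = maximal_minor A"
      using P by (auto simp: plucker_coordinates_def numeral_2_eq_2)
    obtain C where C: "C \<in> carrier_mat (Suc r) (Suc n)" "hadamard_power n L r = proj_rowspan n C"
      and Q: "Q = maximal_minor C"
      using Q by (auto simp: plucker_coordinates_def)
    have "proj_rowspan n C = proj_rowspan n (power_matrix r A)"
      using power[OF A] C(2) by simp
    from proj_rowspan_eq_imp_minors[OF power_matrix_carrier[OF A(1)] C(1) this ix0 minor[OF A]]
    obtain c where "c \<noteq> 0"
      "\<And>ix. ix \<in> index_lists n r \<Longrightarrow> maximal_minor C ix = c * maximal_minor (power_matrix r A) ix"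
      by blast
    then show ?thesis
      by (auto simp: P Q maximal_minor_power_matrix_eq_prod[OF A(1)])
  qed
  have rank: "vec_space.rank (Suc r) (power_matrix r A) = Suc r"
    if A: "A \<in> carrier_mat 2 (Suc n)" "L = proj_rowspan n A" for A
    using vec_space.rank_eq_n_of_maximal_minor[OF power_matrix_carrier[OF A(1)] ix0D det[OF A]] .
  show ?thesis
    using power linear plucker rank maximal_minor_power_matrix_eq_prod by blast
qed

end
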